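(* There exist a closed subspace $Y$ of $c_0$ and a continuous bilinear form $Y\times Y\to\mathbb K$ that cannot be extended to a continuous bilinear form $c_0\times c_0\to\mathbb K$.
   Context: $\mathbb K$ is the scalar field; $c_0$ is the Banach space of scalar null sequences with the supremum norm. *)

theory Defs
  imports "HOL-Analysis.Analysis"
begin

text \<open>
  Since \<^typ>\<open>nat\<close> is discrete, \<open>nat \<Rightarrow>\<^sub>C 'k\<close> is the space of all bounded sequences in \<open>'k\<close> with the
  supremum norm, and \<open>c0\<close> is a closed subspace of it.  The library provides only real scalars on
  this type; \<open>scale_seq\<close> is multiplication by scalars in \<open>'k\<close>.
\<close>

definition scale_seq ::
  "'k::real_normed_field \<Rightarrow> (nat \<Rightarrow>\<^sub>C 'k) \<Rightarrow> (nat \<Rightarrow>\<^sub>C 'k)" where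
  "scale_seq a x = Bcontfun (\<lambda>n. a * x n)"

lemma apply_scale_seq [simp]: "apply_bcontfun (scale_seq a x) n = a * x n"
proof -
  obtain b where b: "\<And>n. norm (x n) \<le> b"
    using bounded_apply_bcontfun[of x] by (auto simp: bounded_iff)
  have "(\<lambda>n. a * x n) \<in> bcontfun"
    by (rule bcontfun_normI[where b = "norm a * b"])
      (auto simp: norm_mult intro: mult_left_mono b)
  then show ?thesis
    by (simp add: scale_seq_def Bcontfun_inverse)
qed

interpretation seq: vector_space "scale_seq :: 'k::real_normed_field \<Rightarrow> _"
  by unfold_locales
    (auto intro!: bcontfun_eqI simp: plus_bcontfun.rep_eq algebra_simps)

definition c0 :: "(nat \<Rightarrow>\<^sub>C 'k::real_normed_field) set" where
  "c0 = {x. apply_bcontfun x \<longlonglongrightarrow> 0}"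

lemma subspace_c0: "seq.subspace (c0 :: (nat \<Rightarrow>\<^sub>C 'k::real_normed_field) set)"
proof (rule seq.subspaceI)
  show "0 \<in> c0"
    by (simp add: c0_def)
next
  fix x y :: "nat \<Rightarrow>\<^sub>C 'k"
  assume "x \<in> c0" "y \<in> c0"
  then show "x + y \<in> c0"
    using tendsto_add[of x 0 sequentially y 0]
    by (simp add: c0_def plus_bcontfun.rep_eq)
next
  fix a :: 'k and x :: "nat \<Rightarrow>\<^sub>C 'k"
  assume "x \<in> c0"
  then have "(\<lambda>n. a * x n) \<longlonglongrightarrow> 0"
    by (simp add: c0_def tendsto_mult_right_zero)
  moreover have "apply_bcontfun (scale_seq a x) = (\<lambda>n. a * x n)"
    by (rule ext) simp
  ultimately show "scale_seq a x \<in> c0"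
    by (simp add: c0_def)
qed

lemma closed_c0: "closed (c0 :: (nat \<Rightarrow>\<^sub>C 'k::real_normed_field) set)"
proof -
  have "l \<in> c0" if X: "\<And>m. X m \<in> c0" and lim: "X \<longlonglongrightarrow> l"
    for X :: "nat \<Rightarrow> nat \<Rightarrow>\<^sub>C 'k" and l
  proof -
    have "apply_bcontfun l \<longlonglongrightarrow> 0"
    proof (rule LIMSEQ_I)
      fix e :: real
      assume "0 < e"
      with lim obtain m where m: "dist (X m) l < e / 2"
        by (meson half_gt_zero metric_LIMSEQ_D order_refl)
      have "apply_bcontfun (X m) \<longlonglongrightarrow> 0"
        using X by (simp add: c0_def)
      with \<open>0 < e\<close> obtain N where N: "\<And>n. n \<ge> N \<Longrightarrow> norm (X m n) < e / 2"
        by (metis LIMSEQ_D diff_zero half_gt_zero)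
      show "\<exists>N. \<forall>n\<ge>N. norm (l n - 0) < e"
      proof (intro exI allI impI)
        fix n
        assume "N \<le> n"
        have "dist (X m n) (l n) < e / 2"
          using dist_bounded[of "X m" n l] m by linarith
        then show "norm (l n - 0) < e"
          using N[OF \<open>N \<le> n\<close>] norm_triangle_ineq2[of "l n" "X m n"]
          by (simp add: dist_norm norm_minus_commute)
      qed
    qed
    then show ?thesis
      by (simp add: c0_def)
  qed
  then show ?thesis
    by (auto simp: closed_sequential_limits)
qed

text \<open>Values of \<open>B\<close> outside \<open>Y \<times> Y\<close> are irrelevant.\<close>

definition continuous_bilinear_form_on ::
  "(nat \<Rightarrow>\<^sub>C 'k::real_normed_field) set \<Rightarrow> ((nat \<Rightarrow>\<^sub>C 'k) \<Rightarrow> (nat \<Rightarrow>\<^sub>C 'k) \<Rightarrow> 'k) \<Rightarrow> bool" where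
  "continuous_bilinear_form_on Y B \<longleftrightarrow>
     (\<forall>x\<in>Y. \<forall>x'\<in>Y. \<forall>y\<in>Y. B (x + x') y = B x y + B x' y) \<and>
     (\<forall>x\<in>Y. \<forall>y\<in>Y. \<forall>y'\<in>Y. B x (y + y') = B x y + B x y') \<and>
     (\<forall>a. \<forall>x\<in>Y. \<forall>y\<in>Y. B (scale_seq a x) y = a * B x y) \<and>
     (\<forall>a. \<forall>x\<in>Y. \<forall>y\<in>Y. B x (scale_seq a y) = a * B x y) \<and>
     continuous_on (Y \<times> Y) (\<lambda>(x, y). B x y)"

end

theory Submission
  imports Defs
begin

text \<open>
  The obstruction is finite-dimensional.  Pair the sup-norm space \<open>\<ell>\<^sub>\<infinity>\<close> of dimension \<open>N\<close> with its
  dual \<open>\<ell>\<^sub>1\<close> by \<open>\<Sum>i. x i * a i\<close>; this bilinear form has norm 1.  The first space is spanned by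
  \<open>N\<close> unit vectors of \<open>c0\<close>.  The second embeds into a sup-norm space on \<open>2 ^ N\<close> coordinates
  by sending \<open>a\<close> to the family of all signed sums \<open>\<Sum>i. \<plusminus> a i\<close>: choosing the signs well makes
  such a sum as large as \<open>\<Sum>i. \<bar>a i\<bar>\<close>, up to a factor 2 for complex scalars.

  Every extension \<open>C\<close> of the pairing to the whole of \<open>c0\<close> has norm at least a constant times
  \<open>sqrt N\<close>.  The reason is that the operator from \<open>c0\<close> to its dual (a space of cotype 2) given by
  \<open>C\<close> sends \<open>N\<close> distinct unit vectors to functionals whose norms sum to at most a constant times
  \<open>sqrt N * norm C\<close>, whereas the pairing forces each of these norms to be at least 1.
  Lemma \<open>bilinear_form_unit_seq_bound\<close> proves the part of this that is needed by an explicit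
  average.  For signs \<open>\<eta>\<close> put \<open>f \<eta> = \<Sum>i. \<eta> i * e i\<close>, of norm 1, and let \<open>g \<eta>\<close> be the
  imaginary part of the Riesz product \<open>\<Prod>j. 1 + \<i> * \<eta> j * y j / sqrt N\<close>.  It is bounded by 2,
  and the mean of \<open>\<eta> i * g \<eta>\<close> over all \<open>\<eta>\<close> is \<open>y i / sqrt N\<close>.  So the mean of
  \<open>C (f \<eta>) (g \<eta>)\<close>, which the norm of \<open>C\<close> controls, is \<open>(\<Sum>i. C (e i) (y i)) / sqrt N\<close>.

  To obtain one form without any continuous extension, infinitely many such pairings are placed
  on disjoint blocks of coordinates: block \<open>k\<close> has \<open>N = 16 ^ k\<close> and weight \<open>1 / 2 ^ k\<close>.  The
  weights are summable, so the sum of the weighted pairings is continuous; and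
  \<open>sqrt (16 ^ k) / 2 ^ k = 2 ^ k\<close> is unbounded, so it has no continuous extension.
  The argument works over every complete normed field in which signed sums
  dominate the sum of the norms; for the real and the complex numbers this is
  \<open>real_signs_norm\<close> and \<open>complex_signs_norm\<close>.
\<close>

section \<open>Null sequences as points of the sequence space\<close>

lemma apply_Bcontfun_null [simp]:
  fixes f :: "nat \<Rightarrow> 'k::real_normed_field"
  assumes "f \<longlonglongrightarrow> 0"
  shows "apply_bcontfun (Bcontfun f) = f"
proof -
  have "Bseq f"
    using assms by (intro convergent_imp_Bseq) (auto simp: convergent_def)
  then obtain b where "\<And>n. norm (f n) \<le> b"
    by (auto simp: Bseq_def)
  then have "f \<in> bcontfun"
    by (intro bcontfun_normI[where b = b]) auto
  then show ?thesis
    by (rule Bcontfun_inverse)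
qed

lemma Bcontfun_null_in_c0:
  fixes f :: "nat \<Rightarrow> 'k::real_normed_field"
  assumes "f \<longlonglongrightarrow> 0"
  shows "Bcontfun f \<in> c0"
  using assms by (simp add: c0_def)

lemma finite_support_tendsto_0:
  fixes f :: "nat \<Rightarrow> 'b::real_normed_vector"
  assumes "finite F" and "\<And>n. n \<notin> F \<Longrightarrow> f n = 0"
  shows "f \<longlonglongrightarrow> 0"
proof (rule tendsto_eventually)
  have "f n = 0" if "n > Max (insert 0 F)" for n
    using assms that Max_ge[of "insert 0 F" n] by force
  then show "\<forall>\<^sub>F n in sequentially. f n = 0"
    unfolding eventually_at_top_dense by blast
qed

definition unit_seq :: "nat \<Rightarrow> (nat \<Rightarrow>\<^sub>C 'k::real_normed_field)" where
  "unit_seq p = Bcontfun (\<lambda>n. if n = p then 1 else 0)"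

lemma unit_seq_tendsto: "(\<lambda>n. if n = p then 1 else 0 :: 'k::real_normed_field) \<longlonglongrightarrow> 0"
  by (rule finite_support_tendsto_0[of "{p}"]) auto

lemma apply_unit_seq [simp]: "apply_bcontfun (unit_seq p) n = (if n = p then 1 else 0)"
  unfolding unit_seq_def by (subst apply_Bcontfun_null[OF unit_seq_tendsto]) simp

lemma unit_seq_in_c0: "unit_seq p \<in> c0"
  unfolding unit_seq_def by (rule Bcontfun_null_in_c0[OF unit_seq_tendsto])

lemma apply_sum_bcontfun:
  fixes x :: "'i \<Rightarrow> (nat \<Rightarrow>\<^sub>C 'k::real_normed_field)"
  shows "apply_bcontfun (\<Sum>i\<in>I. x i) n = (\<Sum>i\<in>I. apply_bcontfun (x i) n)"
  by (induction I rule: infinite_finite_induct) (auto simp: plus_bcontfun.rep_eq)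

lemma norm_scale_seq_le:
  fixes x :: "nat \<Rightarrow>\<^sub>C 'k::real_normed_field"
  shows "norm (scale_seq a x) \<le> norm a * norm x"
  by (rule norm_bound) (simp add: norm_mult mult_left_mono norm_bounded)


section \<open>Continuity and boundedness of bilinear forms\<close>

lemma linear_on_subspace_sum:
  fixes x :: "'i \<Rightarrow> (nat \<Rightarrow>\<^sub>C 'k::real_normed_field)"
  assumes Y: "seq.subspace Y"
    and add: "\<And>v w. v \<in> Y \<Longrightarrow> w \<in> Y \<Longrightarrow> L (v + w) = L v + L w"
    and scale: "\<And>c v. v \<in> Y \<Longrightarrow> L (scale_seq c v) = c * L v"
    and x: "\<And>i. i \<in> I \<Longrightarrow> x i \<in> Y"
  shows "L (\<Sum>i\<in>I. scale_seq (a i) (x i)) = (\<Sum>i\<in>I. a i * L (x i))"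
proof -
  have "L 0 = 0"
    using scale[OF seq.subspace_0[OF Y], of 0] by simp
  then show ?thesis
    using x
  proof (induction I rule: infinite_finite_induct)
    case (insert i I)
    have "scale_seq (a i) (x i) \<in> Y" "(\<Sum>i\<in>I. scale_seq (a i) (x i)) \<in> Y"
      using insert.prems Y by (auto intro!: seq.subspace_scale seq.subspace_sum)
    then show ?case
      using insert by (simp add: add scale)
  qed auto
qed

lemma bilinear_sum_left:
  fixes x :: "'i \<Rightarrow> (nat \<Rightarrow>\<^sub>C 'k::real_normed_field)"
  assumes Y: "seq.subspace Y" and B: "continuous_bilinear_form_on Y B"
    and x: "\<And>i. i \<in> I \<Longrightarrow> x i \<in> Y" and y: "y \<in> Y"
  shows "B (\<Sum>i\<in>I. scale_seq (a i) (x i)) y = (\<Sum>i\<in>I. a i * B (x i) y)"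
  using B y by (intro linear_on_subspace_sum[OF Y, where L = "\<lambda>v. B v y"] x)
    (auto simp: continuous_bilinear_form_on_def)

lemma bilinear_sum_right:
  fixes x :: "'i \<Rightarrow> (nat \<Rightarrow>\<^sub>C 'k::real_normed_field)"
  assumes Y: "seq.subspace Y" and B: "continuous_bilinear_form_on Y B"
    and x: "\<And>i. i \<in> I \<Longrightarrow> x i \<in> Y" and y: "y \<in> Y"
  shows "B y (\<Sum>i\<in>I. scale_seq (a i) (x i)) = (\<Sum>i\<in>I. a i * B y (x i))"
  using B y by (intro linear_on_subspace_sum[OF Y, where L = "B y"] x)
    (auto simp: continuous_bilinear_form_on_def)

text \<open>
  Boundedness gives joint continuity through
  \<open>B q r - B x y = B (q - x) r + B x (r - y)\<close>.
\<close>

lemma continuous_bilinear_form_onI: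
  fixes B :: "(nat \<Rightarrow>\<^sub>C 'k::real_normed_field) \<Rightarrow> (nat \<Rightarrow>\<^sub>C 'k) \<Rightarrow> 'k"
  assumes Y: "seq.subspace Y"
    and add_left: "\<And>x x' y. x \<in> Y \<Longrightarrow> x' \<in> Y \<Longrightarrow> y \<in> Y \<Longrightarrow> B (x + x') y = B x y + B x' y"
    and add_right: "\<And>x y y'. x \<in> Y \<Longrightarrow> y \<in> Y \<Longrightarrow> y' \<in> Y \<Longrightarrow> B x (y + y') = B x y + B x y'"
    and scale_left: "\<And>a x y. x \<in> Y \<Longrightarrow> y \<in> Y \<Longrightarrow> B (scale_seq a x) y = a * B x y"
    and scale_right: "\<And>a x y. x \<in> Y \<Longrightarrow> y \<in> Y \<Longrightarrow> B x (scale_seq a y) = a * B x y"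
    and bound: "\<And>x y. x \<in> Y \<Longrightarrow> y \<in> Y \<Longrightarrow> norm (B x y) \<le> M * norm x * norm y"
  shows "continuous_bilinear_form_on Y B"
proof -
  have "continuous (at p within Y \<times> Y) (\<lambda>(x, y). B x y)" if p: "p \<in> Y \<times> Y" for p
  proof -
    obtain x y where p_eq: "p = (x, y)" and x: "x \<in> Y" and y: "y \<in> Y"
      using p by auto
    let ?F = "at (x, y) within Y \<times> Y"
    have le: "norm (B (fst q) (snd q) - B x y)
        \<le> M * norm (fst q - x) * norm (snd q) + M * norm x * norm (snd q - y)"
      if q: "q \<in> Y \<times> Y" for q
    proof -
      have q1: "fst q \<in> Y" and q2: "snd q \<in> Y"
        using q by auto
      note [intro] = x y q1 q2 seq.subspace_diff[OF Y]
      have "B (fst q) (snd q) = B (fst q - x) (snd q) + B x (snd q)"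
        using add_left[of "fst q - x" x "snd q"] by auto
      moreover have "B x (snd q) = B x (snd q - y) + B x y"
        using add_right[of x "snd q - y" y] by auto
      ultimately have "B (fst q) (snd q) - B x y = B (fst q - x) (snd q) + B x (snd q - y)"
        by simp
      also have "norm \<dots> \<le> norm (B (fst q - x) (snd q)) + norm (B x (snd q - y))"
        by (rule norm_triangle_ineq)
      also have "\<dots> \<le> M * norm (fst q - x) * norm (snd q) + M * norm x * norm (snd q - y)"
        by (intro add_mono bound) auto
      finally show ?thesis .
    qed
    have "((\<lambda>q. M * norm (fst q - x) * norm (snd q) + M * norm x * norm (snd q - y))
        \<longlongrightarrow> M * norm (x - x) * norm y + M * norm x * norm (y - y)) ?F"
      by (intro tendsto_intros tendsto_eq_intros) (auto intro!: tendsto_eq_intros)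
    then have "((\<lambda>q. M * norm (fst q - x) * norm (snd q) + M * norm x * norm (snd q - y))
        \<longlongrightarrow> 0) ?F"
      by simp
    then have "((\<lambda>q. B (fst q) (snd q) - B x y) \<longlongrightarrow> 0) ?F"
      by (rule Lim_null_comparison[rotated])
        (simp only: eventually_at_filter, intro always_eventually allI impI le)
    then have "((\<lambda>q. B (fst q) (snd q)) \<longlongrightarrow> B x y) ?F"
      by (rule LIM_zero_cancel)
    then show ?thesis
      by (simp add: continuous_within p_eq split_def)
  qed
  then have "continuous_on (Y \<times> Y) (\<lambda>(x, y). B x y)"
    by (simp add: continuous_on_eq_continuous_within)
  then show ?thesis
    unfolding continuous_bilinear_form_on_def
    using add_left add_right scale_left scale_right by auto
qed

text \<open>Continuity at the origin bounds the form on a small ball; scaling carries this to any ball.\<close>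

lemma continuous_bilinear_form_bounded_on_balls:
  fixes C :: "(nat \<Rightarrow>\<^sub>C 'k::real_normed_field) \<Rightarrow> (nat \<Rightarrow>\<^sub>C 'k) \<Rightarrow> 'k"
  assumes Y: "seq.subspace Y" and C: "continuous_bilinear_form_on Y C" and "r > 0"
  obtains M where
    "\<And>x y. x \<in> Y \<Longrightarrow> y \<in> Y \<Longrightarrow> norm x \<le> r \<Longrightarrow> norm y \<le> r \<Longrightarrow> norm (C x y) \<le> M"
proof -
  have Cs: "\<And>a x y. x \<in> Y \<Longrightarrow> y \<in> Y \<Longrightarrow> C (scale_seq a x) y = a * C x y"
      "\<And>a x y. x \<in> Y \<Longrightarrow> y \<in> Y \<Longrightarrow> C x (scale_seq a y) = a * C x y"
    and cont: "continuous_on (Y \<times> Y) (\<lambda>(x, y). C x y)"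
    using C unfolding continuous_bilinear_form_on_def by blast+
  have zero: "0 \<in> Y"
    by (rule seq.subspace_0[OF Y])
  have C0: "C 0 0 = 0"
    using Cs(1)[OF zero zero, of 0] by simp
  have "(0, 0) \<in> Y \<times> Y"
    using zero by simp
  then have "\<exists>d>0. \<forall>q\<in>Y \<times> Y. dist q (0, 0) < d \<longrightarrow>
      dist (case q of (x, y) \<Rightarrow> C x y) (case (0, 0) of (x, y) \<Rightarrow> C x y) < 1"
    using cont[unfolded continuous_on_iff, rule_format, of "(0, 0)" 1] by simp
  then obtain d where d: "d > 0"
    and close: "\<And>x y. x \<in> Y \<Longrightarrow> y \<in> Y \<Longrightarrow> dist (x, y) (0, 0) < d \<Longrightarrow> dist (C x y) (C 0 0) < 1"
    by auto
  define s where "s = d / (4 * r)"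
  have s: "s > 0"
    using d \<open>r > 0\<close> by (simp add: s_def)
  show ?thesis
  proof (rule that)
    fix x y
    assume xy: "x \<in> Y" "y \<in> Y" and nx: "norm x \<le> r" and ny: "norm y \<le> r"
    let ?x = "scale_seq (of_real s) x" and ?y = "scale_seq (of_real s) y"
    have small: "norm (scale_seq (of_real s) z) \<le> d / 4" if "norm z \<le> r" for z :: "nat \<Rightarrow>\<^sub>C 'k"
    proof -
      have "norm (scale_seq (of_real s) z) \<le> s * norm z"
        using norm_scale_seq_le[of "of_real s" z] s by simp
      also have "\<dots> \<le> s * r"
        using that s by simp
      also have "\<dots> = d / 4"
        using \<open>r > 0\<close> by (simp add: s_def)
      finally show ?thesis .
    qed
    have in_Y: "?x \<in> Y" "?y \<in> Y"
      using xy Y by (auto intro: seq.subspace_scale)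
    have "dist (?x, ?y) (0, 0) \<le> norm ?x + norm ?y"
      using norm_Pair_le[of ?x ?y] by (simp add: dist_norm)
    also have "\<dots> < d"
      using small[OF nx] small[OF ny] d by linarith
    finally have "norm (C ?x ?y) < 1"
      using close[of ?x ?y] in_Y C0 by (simp add: dist_norm)
    moreover have "C ?x ?y = of_real s * (of_real s * C x y)"
      using Cs xy in_Y by simp
    ultimately have "s * (s * norm (C x y)) < 1"
      using s by (simp add: norm_mult)
    then show "norm (C x y) \<le> 1 / (s * s)"
      using s by (simp add: field_simps)
  qed
qed


section \<open>Riesz products\<close>

text \<open>
  The signs \<open>\<eta> j\<close> are independent with mean 0.  The sum over \<open>\<eta>\<close> therefore factors over the
  indices: each \<open>j \<noteq> i\<close> contributes 2, and \<open>i\<close> contributes \<open>2 * c i\<close> because its sign is squared.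
\<close>

lemma riesz_product_coefficient:
  fixes c :: "nat \<Rightarrow> complex"
  assumes i: "i < N"
  shows "(\<Sum>\<eta>\<in>PiE {..<N} (\<lambda>_. {1, -1::real}).
      of_real (\<eta> i) * (\<Prod>j<N. 1 + of_real (\<eta> j) * c j)) = 2 ^ N * c i"
proof -
  let ?h = "\<lambda>j (s::real). (if j = i then of_real s else 1) * (1 + of_real s * c j)"
  have "of_real (\<eta> i) * (\<Prod>j<N. 1 + of_real (\<eta> j) * c j) = (\<Prod>j<N. ?h j (\<eta> j))"
    for \<eta> :: "nat \<Rightarrow> real"
  proof -
    have "(\<Prod>j<N. if j = i then of_real (\<eta> j) else 1 :: complex) = of_real (\<eta> i)"
      using i by (simp add: prod.delta)
    then show ?thesis
      by (simp add: prod.distrib)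
  qed
  then have "(\<Sum>\<eta>\<in>PiE {..<N} (\<lambda>_. {1, -1::real}).
      of_real (\<eta> i) * (\<Prod>j<N. 1 + of_real (\<eta> j) * c j))
      = (\<Sum>\<eta>\<in>PiE {..<N} (\<lambda>_. {1, -1::real}). \<Prod>j<N. ?h j (\<eta> j))"
    by simp
  also have "\<dots> = (\<Prod>j<N. \<Sum>s\<in>{1, -1}. ?h j s)"
    by (rule prod_sum_PiE[symmetric]) auto
  also have "\<dots> = (\<Prod>j<N. 2 * (if j = i then c j else 1))"
    by (rule prod.cong) (auto simp: algebra_simps)
  also have "\<dots> = 2 ^ N * c i"
    using i by (simp add: prod.distrib prod.delta)
  finally show ?thesis .
qed

text \<open>
  Factors with purely imaginary increments exceed modulus 1 only to second order, so
  increments of size \<open>1 / sqrt N\<close> keep the product of \<open>N\<close> of them below \<open>sqrt (exp 1)\<close>.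
\<close>

lemma riesz_product_bounded:
  fixes v :: "nat \<Rightarrow> real"
  assumes v: "\<And>j. j < N \<Longrightarrow> \<bar>v j\<bar> \<le> 1 / sqrt N"
  shows "cmod (\<Prod>j<N. 1 + \<i> * of_real (v j)) \<le> 2"
proof -
  have "cmod (\<Prod>j<N. 1 + \<i> * of_real (v j)) = (\<Prod>j<N. sqrt (1 + (v j)\<^sup>2))"
    by (simp only: prod_norm[symmetric]) (simp add: cmod_def)
  also have "\<dots> \<le> (\<Prod>j<N. sqrt (exp (1 / N)))"
  proof (intro prod_mono conjI real_sqrt_le_mono)
    fix j
    assume "j \<in> {..<N}"
    then have "\<bar>v j\<bar>\<^sup>2 \<le> (1 / sqrt N)\<^sup>2"
      by (intro power_mono v) auto
    then have "1 + (v j)\<^sup>2 \<le> 1 + 1 / N"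
      by (simp add: power_divide)
    also have "\<dots> \<le> exp (1 / N)"
      by (rule exp_ge_add_one_self)
    finally show "1 + (v j)\<^sup>2 \<le> exp (1 / N)" .
  qed auto
  also have "\<dots> = sqrt (exp (1 / N) ^ N)"
    by (simp add: real_sqrt_power)
  also have "\<dots> \<le> sqrt 4"
  proof (rule real_sqrt_le_mono)
    show "exp (1 / N) ^ N \<le> (4::real)"
      using exp_le by (cases "N = 0") (simp_all flip: exp_of_nat_mult)
  qed
  finally show ?thesis
    by simp
qed


section \<open>Bilinear forms on null sequences\<close>

text \<open>
  Bounding each summand separately gives only \<open>N * M\<close>.  The gain of a factor \<open>sqrt N\<close> is
  what makes extensions of the pairing large, since there every summand equals the same weight.
\<close>

lemma bilinear_form_unit_seq_bound:
  fixes C :: "(nat \<Rightarrow>\<^sub>C 'k::real_normed_field) \<Rightarrow> (nat \<Rightarrow>\<^sub>C 'k) \<Rightarrow> 'k"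
    and p :: "nat \<Rightarrow> nat" and u :: "nat \<Rightarrow> nat \<Rightarrow> real" and N :: nat
  assumes C: "continuous_bilinear_form_on c0 C"
    and M: "\<And>x y. x \<in> c0 \<Longrightarrow> y \<in> c0 \<Longrightarrow> norm x \<le> 2 \<Longrightarrow> norm y \<le> 2 \<Longrightarrow> norm (C x y) \<le> M"
    and p: "inj_on p {..<N}"
    and u_le: "\<And>i n. i < N \<Longrightarrow> \<bar>u i n\<bar> \<le> 1"
    and u_lim: "\<And>i. i < N \<Longrightarrow> u i \<longlonglongrightarrow> 0"
  shows "norm (\<Sum>i<N. C (unit_seq (p i)) (Bcontfun (\<lambda>n. of_real (u i n)))) \<le> sqrt N * M"
proof (cases "N = 0")
  case False
  define E where "E = PiE {..<N} (\<lambda>_. {1, -1::real})"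
  define t where "t = 1 / sqrt N"
  have t: "t > 0" and tN: "sqrt N * t = 1"
    using False by (simp_all add: t_def)
  define y :: "nat \<Rightarrow> (nat \<Rightarrow>\<^sub>C 'k)" where "y i = Bcontfun (\<lambda>n. of_real (u i n))" for i
  have y_lim: "(\<lambda>n. of_real (u i n) :: 'k) \<longlonglongrightarrow> 0" if "i < N" for i
    using tendsto_of_real[OF u_lim[OF that]] by simp
  have y_apply: "apply_bcontfun (y i) = (\<lambda>n. of_real (u i n))" if "i < N" for i
    using y_lim[OF that] by (simp add: y_def)
  have y_c0: "y i \<in> c0" if "i < N" for i
    using y_lim[OF that] unfolding y_def by (rule Bcontfun_null_in_c0)
  define R where "R \<eta> n = (\<Prod>j<N. 1 + \<i> * of_real (\<eta> j * (t * u j n)))" for \<eta> n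
  define f :: "(nat \<Rightarrow> real) \<Rightarrow> (nat \<Rightarrow>\<^sub>C 'k)"
    where "f \<eta> = (\<Sum>i<N. scale_seq (of_real (\<eta> i)) (unit_seq (p i)))" for \<eta>
  \<comment> \<open>Taking imaginary parts keeps the functions \<open>g \<eta>\<close> real, so that one argument serves all scalar
     fields, and removes the constant term 1, which makes them null sequences.\<close>
  define g :: "(nat \<Rightarrow> real) \<Rightarrow> (nat \<Rightarrow>\<^sub>C 'k)"
    where "g \<eta> = Bcontfun (\<lambda>n. of_real (Im (R \<eta> n)))" for \<eta>
  have abs_\<eta>: "\<bar>\<eta> i\<bar> = 1" if "\<eta> \<in> E" "i < N" for \<eta> i
    using PiE_mem[OF that(1)[unfolded E_def], of i] that(2) by auto
  have g_lim: "(\<lambda>n. of_real (Im (R \<eta> n)) :: 'k) \<longlonglongrightarrow> 0" for \<eta>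
  proof -
    have "(\<lambda>n. R \<eta> n) \<longlonglongrightarrow> (\<Prod>j<N. 1 + \<i> * of_real (\<eta> j * (t * 0)))"
      unfolding R_def by (intro tendsto_intros u_lim) auto
    then have "(\<lambda>n. of_real (Im (R \<eta> n)) :: 'k) \<longlonglongrightarrow> of_real (Im 1)"
      by (intro tendsto_of_real tendsto_Im) simp
    then show ?thesis
      by simp
  qed
  have g_apply: "apply_bcontfun (g \<eta>) = (\<lambda>n. of_real (Im (R \<eta> n)))" for \<eta>
    using g_lim by (simp add: g_def)
  have g_c0: "g \<eta> \<in> c0" for \<eta>
    unfolding g_def by (rule Bcontfun_null_in_c0[OF g_lim])
  have g_norm: "norm (g \<eta>) \<le> 2" if "\<eta> \<in> E" for \<eta>
  proof (rule norm_bound)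
    fix n
    have "\<bar>\<eta> j * (t * u j n)\<bar> \<le> 1 / sqrt N" if "j < N" for j
      using abs_\<eta>[OF \<open>\<eta> \<in> E\<close> that] u_le[OF that, of n] t by (simp add: abs_mult t_def divide_right_mono)
    then have "cmod (R \<eta> n) \<le> 2"
      unfolding R_def by (rule riesz_product_bounded)
    then show "norm (apply_bcontfun (g \<eta>) n) \<le> 2"
      using abs_Im_le_cmod[of "R \<eta> n"] by (simp add: g_apply)
  qed
  have f_c0: "f \<eta> \<in> c0" for \<eta>
    unfolding f_def
    by (intro seq.subspace_sum[OF subspace_c0] seq.subspace_scale[OF subspace_c0] unit_seq_in_c0)
  have f_norm: "norm (f \<eta>) \<le> 2" if "\<eta> \<in> E" for \<eta>
  proof (rule norm_bound)
    fix n
    have f_n: "apply_bcontfun (f \<eta>) n = (\<Sum>i<N. if n = p i then of_real (\<eta> i) else 0)"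
      by (auto simp: f_def apply_sum_bcontfun intro!: sum.cong)
    show "norm (apply_bcontfun (f \<eta>) n) \<le> 2"
    proof (cases "\<exists>i<N. n = p i")
      case True
      then obtain i where i: "i < N" "n = p i"
        by blast
      have "apply_bcontfun (f \<eta>) n = (\<Sum>j<N. if j = i then of_real (\<eta> j) else 0)"
        unfolding f_n using i p by (intro sum.cong) (auto simp: inj_on_def)
      then show ?thesis
        using i abs_\<eta>[OF that] by (simp add: sum.delta)
    next
      case False
      then have "apply_bcontfun (f \<eta>) n = 0"
        unfolding f_n by (intro sum.neutral) auto
      then show ?thesis
        by simp
    qed
  qed
  have avg: "(\<Sum>\<eta>\<in>E. scale_seq (of_real (\<eta> i)) (g \<eta>)) = scale_seq (of_real (2 ^ N * t)) (y i)"
    if i: "i < N" for i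
  proof (rule bcontfun_eqI)
    fix n
    have "(\<Sum>\<eta>\<in>E. of_real (\<eta> i) * R \<eta> n)
        = 2 ^ N * (\<i> * of_real (t * u i n))"
      using riesz_product_coefficient[OF i, of "\<lambda>j. \<i> * of_real (t * u j n)"]
      by (simp add: E_def R_def mult_ac)
    then have "Im (\<Sum>\<eta>\<in>E. of_real (\<eta> i) * R \<eta> n) = Im (of_real (2 ^ N * t * u i n) * \<i>)"
      by (simp add: mult_ac)
    then have "(\<Sum>\<eta>\<in>E. \<eta> i * Im (R \<eta> n)) = 2 ^ N * t * u i n"
      by simp
    then have "of_real (\<Sum>\<eta>\<in>E. \<eta> i * Im (R \<eta> n)) = (of_real (2 ^ N * t * u i n) :: 'k)"
      by simp
    then show "apply_bcontfun (\<Sum>\<eta>\<in>E. scale_seq (of_real (\<eta> i)) (g \<eta>)) n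
        = apply_bcontfun (scale_seq (of_real (2 ^ N * t)) (y i)) n"
      by (simp add: apply_sum_bcontfun g_apply y_apply[OF i])
  qed
  have scale_right: "C x (scale_seq a z) = a * C x z" if "x \<in> c0" "z \<in> c0" for a x z
    using C that unfolding continuous_bilinear_form_on_def by blast
  have card_E: "card E = 2 ^ N"
    by (simp add: E_def card_PiE numeral_2_eq_2[symmetric])
  have "(\<Sum>\<eta>\<in>E. C (f \<eta>) (g \<eta>)) = (\<Sum>\<eta>\<in>E. \<Sum>i<N. of_real (\<eta> i) * C (unit_seq (p i)) (g \<eta>))"
    unfolding f_def
    by (intro sum.cong refl bilinear_sum_left[OF subspace_c0 C] unit_seq_in_c0 g_c0)
  also have "\<dots> = (\<Sum>i<N. \<Sum>\<eta>\<in>E. of_real (\<eta> i) * C (unit_seq (p i)) (g \<eta>))"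
    by (rule sum.swap)
  also have "\<dots> = (\<Sum>i<N. C (unit_seq (p i)) (\<Sum>\<eta>\<in>E. scale_seq (of_real (\<eta> i)) (g \<eta>)))"
    by (intro sum.cong refl bilinear_sum_right[OF subspace_c0 C, symmetric] unit_seq_in_c0 g_c0)
  also have "\<dots> = (\<Sum>i<N. of_real (2 ^ N * t) * C (unit_seq (p i)) (y i))"
    by (intro sum.cong refl) (simp only: avg lessThan_iff scale_right unit_seq_in_c0 y_c0)
  also have "\<dots> = of_real (2 ^ N * t) * (\<Sum>i<N. C (unit_seq (p i)) (y i))"
    by (simp only: sum_distrib_left)
  finally have eq: "(\<Sum>\<eta>\<in>E. C (f \<eta>) (g \<eta>)) = of_real (2 ^ N * t) * (\<Sum>i<N. C (unit_seq (p i)) (y i))" .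
  have "2 ^ N * t * norm (\<Sum>i<N. C (unit_seq (p i)) (y i)) = norm (\<Sum>\<eta>\<in>E. C (f \<eta>) (g \<eta>))"
    unfolding eq norm_mult norm_of_real using t by simp
  also have "\<dots> \<le> (\<Sum>\<eta>\<in>E. M)"
    by (intro sum_norm_le M f_c0 g_c0 f_norm g_norm)
  also have "\<dots> = 2 ^ N * M"
    by (simp add: card_E)
  finally have "t * norm (\<Sum>i<N. C (unit_seq (p i)) (y i)) \<le> M"
    by simp
  then have "sqrt N * (t * norm (\<Sum>i<N. C (unit_seq (p i)) (y i))) \<le> sqrt N * M"
    by (intro mult_left_mono) auto
  then show ?thesis
    using tN by (simp add: y_def mult.assoc[symmetric])
qed simp


section \<open>Weighted pairings on disjoint blocks\<close>

text \<open>
  Block \<open>k\<close> has three groups of coordinates: free ones that carry the \<open>\<ell>\<^sub>\<infinity>\<close> variable, coefficient ones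
  that carry the \<open>\<ell>\<^sub>1\<close> variable \<open>a\<close>, and one for each sign pattern, which on the subspace carries
  the corresponding signed sum of \<open>a\<close>.  The signed sums give the subspace the \<open>\<ell>\<^sub>1\<close> norm; keeping \<open>a\<close>
  itself as coordinates lets the subspace be cut out by equations between evaluations.
  The size \<open>16 ^ k\<close> makes \<open>sqrt (block_size k)\<close> outgrow the inverse weight \<open>2 ^ k\<close>.
\<close>

definition block_size :: "nat \<Rightarrow> nat" where
  "block_size k = 16 ^ k"

definition free_index :: "nat \<Rightarrow> nat \<Rightarrow> nat" where
  "free_index k i = prod_encode (0, prod_encode (k, i))"

definition coeff_index :: "nat \<Rightarrow> nat \<Rightarrow> nat" where
  "coeff_index k i = prod_encode (1, prod_encode (k, i))"

definition sum_index :: "nat \<Rightarrow> nat set \<Rightarrow> nat" where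
  "sum_index k S = prod_encode (2, prod_encode (k, set_encode S))"

lemma index_eq_iff [simp]:
  "free_index k i = free_index l j \<longleftrightarrow> k = l \<and> i = j"
  "coeff_index k i = coeff_index l j \<longleftrightarrow> k = l \<and> i = j"
  "finite S \<Longrightarrow> finite T \<Longrightarrow> sum_index k S = sum_index l T \<longleftrightarrow> k = l \<and> S = T"
  "free_index k i \<noteq> coeff_index l j" "coeff_index l j \<noteq> free_index k i"
  "free_index k i \<noteq> sum_index l T" "sum_index l T \<noteq> free_index k i"
  "coeff_index k i \<noteq> sum_index l T" "sum_index l T \<noteq> coeff_index k i"
  by (auto simp: free_index_def coeff_index_def sum_index_def prod_encode_eq set_encode_eq)

text \<open>A sign pattern is represented by the set of indices where it is positive.\<close>

definition sign :: "nat set \<Rightarrow> nat \<Rightarrow> 'a::ring_1" where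
  "sign S i = (if i \<in> S then 1 else - 1)"

lemma of_real_sign [simp]: "of_real (sign S i) = (sign S i :: 'k::real_normed_field)"
  by (simp add: sign_def)

lemma abs_sign [simp]: "\<bar>sign S i\<bar> = (1::real)"
  by (simp add: sign_def)

definition sign_space :: "(nat \<Rightarrow>\<^sub>C 'k::real_normed_field) set" where
  "sign_space = {z \<in> c0. \<forall>k. \<forall>S \<in> Pow {..<block_size k}.
     apply_bcontfun z (sum_index k S) = (\<Sum>i<block_size k. sign S i * apply_bcontfun z (coeff_index k i))}"

definition block_form :: "nat \<Rightarrow> (nat \<Rightarrow>\<^sub>C 'k::real_normed_field) \<Rightarrow> (nat \<Rightarrow>\<^sub>C 'k) \<Rightarrow> 'k" where
  "block_form k x y = (\<Sum>i<block_size k. apply_bcontfun x (free_index k i) * apply_bcontfun y (coeff_index k i))"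

definition sign_form :: "(nat \<Rightarrow>\<^sub>C 'k::real_normed_field) \<Rightarrow> (nat \<Rightarrow>\<^sub>C 'k) \<Rightarrow> 'k" where
  "sign_form x y = (\<Sum>k. of_real ((1/2) ^ k) * block_form k x y)"

lemma block_form_linear:
  "block_form k (x + x') y = block_form k x y + block_form k x' y"
  "block_form k x (y + y') = block_form k x y + block_form k x y'"
  "block_form k (scale_seq a x) y = a * block_form k x y"
  "block_form k x (scale_seq a y) = a * block_form k x y"
  by (simp_all add: block_form_def plus_bcontfun.rep_eq distrib_left distrib_right sum.distrib
      sum_distrib_left mult_ac)

lemma subspace_sign_space: "seq.subspace (sign_space :: (nat \<Rightarrow>\<^sub>C 'k::real_normed_field) set)"
proof (rule seq.subspaceI)
  show "0 \<in> (sign_space :: (nat \<Rightarrow>\<^sub>C 'k) set)"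
    using seq.subspace_0[OF subspace_c0] by (simp add: sign_space_def)
next
  fix x y :: "nat \<Rightarrow>\<^sub>C 'k"
  assume "x \<in> sign_space" "y \<in> sign_space"
  then show "x + y \<in> sign_space"
    using seq.subspace_add[OF subspace_c0, of x y]
    by (simp add: sign_space_def plus_bcontfun.rep_eq distrib_left sum.distrib)
next
  fix a :: 'k and x :: "nat \<Rightarrow>\<^sub>C 'k"
  assume "x \<in> sign_space"
  then show "scale_seq a x \<in> sign_space"
    using seq.subspace_scale[OF subspace_c0, of x a]
    by (simp add: sign_space_def sum_distrib_left mult.left_commute)
qed

lemma continuous_on_eval:
  "continuous_on A (\<lambda>z :: nat \<Rightarrow>\<^sub>C 'k::real_normed_field. apply_bcontfun z n)"
  unfolding continuous_on_iff by (meson dist_fun_lt_imp_dist_val_lt)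

lemma closedin_sign_space:
  "closedin (top_of_set c0) (sign_space :: (nat \<Rightarrow>\<^sub>C 'k::real_normed_field) set)"
proof (rule closed_subset)
  show "(sign_space :: (nat \<Rightarrow>\<^sub>C 'k) set) \<subseteq> c0"
    by (auto simp: sign_space_def)
  have "sign_space = c0 \<inter> (\<Inter>k. \<Inter>S \<in> Pow {..<block_size k}. {z :: nat \<Rightarrow>\<^sub>C 'k.
      apply_bcontfun z (sum_index k S) = (\<Sum>i<block_size k. sign S i * apply_bcontfun z (coeff_index k i))})"
    unfolding sign_space_def by blast
  moreover have "closed \<dots>"
    by (intro closed_Int closed_c0 closed_INT ballI closed_Collect_eq continuous_intros continuous_on_eval)
  ultimately show "closed (sign_space :: (nat \<Rightarrow>\<^sub>C 'k) set)"
    by simp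
qed

lemma unit_seq_free_in_sign_space: "unit_seq (free_index k i) \<in> sign_space"
  using unit_seq_in_c0 by (auto simp: sign_space_def)

text \<open>
  The real sequence behind the member of \<open>sign_space\<close> whose \<open>\<ell>\<^sub>1\<close> variable is the \<open>l\<close>-th basis
  vector of block \<open>k\<close>.  The description operator recovers the sign pattern from the coordinate;
  \<open>sign_vector_sum\<close> evaluates it.
\<close>

definition sign_vector :: "nat \<Rightarrow> nat \<Rightarrow> nat \<Rightarrow> real" where
  "sign_vector k l n =
     (if n = coeff_index k l then 1
      else if n \<in> sum_index k ` Pow {..<block_size k}
        then sign (THE S. finite S \<and> n = sum_index k S) l
      else 0)"

lemma sign_vector_coeff [simp]: "sign_vector k l (coeff_index j i) = of_bool (j = k \<and> i = l)"
  by (auto simp: sign_vector_def)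

lemma sign_vector_sum:
  assumes "S \<subseteq> {..<block_size j}"
  shows "sign_vector k l (sum_index j S) = (if j = k then sign S l else 0)"
proof -
  have S: "finite S"
    using assms finite_subset by blast
  have "sum_index j S \<in> sum_index k ` Pow {..<block_size k} \<longleftrightarrow> j = k"
    using assms S by (auto simp: image_iff dest: finite_subset[OF _ finite_lessThan])
  moreover have "(THE T. finite T \<and> sum_index k S = sum_index k T) = S"
    using S by (auto intro!: the_equality)
  ultimately show ?thesis
    by (auto simp: sign_vector_def)
qed

lemma abs_sign_vector_le: "\<bar>sign_vector k l n\<bar> \<le> 1"
  by (simp add: sign_vector_def)

lemma sign_vector_tendsto_0: "sign_vector k l \<longlonglongrightarrow> 0"
  by (rule finite_support_tendsto_0[of "insert (coeff_index k l) (sum_index k ` Pow {..<block_size k})"])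
    (auto simp: sign_vector_def)

definition sign_seq :: "nat \<Rightarrow> nat \<Rightarrow> (nat \<Rightarrow>\<^sub>C 'k::real_normed_field)" where
  "sign_seq k l = Bcontfun (\<lambda>n. of_real (sign_vector k l n))"

lemma sign_seq_tendsto_0: "(\<lambda>n. of_real (sign_vector k l n) :: 'k::real_normed_field) \<longlonglongrightarrow> 0"
  using tendsto_of_real[OF sign_vector_tendsto_0] by simp

lemma apply_sign_seq [simp]: "apply_bcontfun (sign_seq k l) n = of_real (sign_vector k l n)"
  unfolding sign_seq_def by (subst apply_Bcontfun_null[OF sign_seq_tendsto_0]) simp

lemma sign_seq_in_sign_space:
  assumes l: "l < block_size k"
  shows "(sign_seq k l :: nat \<Rightarrow>\<^sub>C 'k::real_normed_field) \<in> sign_space"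
proof -
  have "(sign_seq k l :: nat \<Rightarrow>\<^sub>C 'k) \<in> c0"
    unfolding sign_seq_def by (rule Bcontfun_null_in_c0[OF sign_seq_tendsto_0])
  moreover have "(of_real (sign_vector k l (sum_index j S)) :: 'k)
      = (\<Sum>i<block_size j. sign S i * of_real (sign_vector k l (coeff_index j i)))"
    if "S \<subseteq> {..<block_size j}" for j S
  proof (cases "j = k")
    case True
    have "(\<Sum>i<block_size j. sign S i * of_real (sign_vector k l (coeff_index j i)) :: 'k)
        = (\<Sum>i<block_size j. if i = l then sign S i else 0)"
      using True by (intro sum.cong) auto
    then show ?thesis
      using l True that by (simp add: sign_vector_sum sum.delta)
  qed (use that in \<open>simp add: sign_vector_sum\<close>)
  ultimately show ?thesis
    by (simp add: sign_space_def)
qed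

lemma sign_form_sign_seq:
  fixes x :: "nat \<Rightarrow>\<^sub>C 'k::real_normed_field"
  assumes l: "l < block_size k"
  shows "sign_form x (sign_seq k l) = of_real ((1/2) ^ k) * apply_bcontfun x (free_index k l)"
proof -
  have "block_form j x (sign_seq k l) = (if j = k then apply_bcontfun x (free_index k l) else 0)" for j
  proof (cases "j = k")
    case True
    have "block_form j x (sign_seq k l) = (\<Sum>i<block_size j. if i = l then apply_bcontfun x (free_index j i) else 0)"
      unfolding block_form_def using True by (intro sum.cong) auto
    then show ?thesis
      using l True by (simp add: sum.delta)
  qed (simp add: block_form_def)
  then have "(\<lambda>j. of_real ((1/2) ^ j) * block_form j x (sign_seq k l))
      = (\<lambda>j. if j = k then of_real ((1/2) ^ k) * apply_bcontfun x (free_index k l) else 0)"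
    by auto
  then show ?thesis
    unfolding sign_form_def using sums_single[of k "\<lambda>_. of_real ((1/2) ^ k) * apply_bcontfun x (free_index k l)"]
    by (simp add: sums_iff)
qed

text \<open>
  On block \<open>k\<close> an extension bounded by \<open>M\<close> on balls of radius 2 satisfies
  \<open>16 ^ k / 2 ^ k \<le> sqrt (16 ^ k) * M\<close>,
  that is \<open>2 ^ k \<le> M\<close>.
\<close>

lemma not_extendable_sign_form:
  "\<not> (\<exists>C. continuous_bilinear_form_on c0 C \<and>
        (\<forall>x\<in>sign_space. \<forall>y\<in>sign_space. C x y = (sign_form x y :: 'k::real_normed_field)))"
proof
  assume "\<exists>C. continuous_bilinear_form_on c0 C \<and>
        (\<forall>x\<in>sign_space. \<forall>y\<in>sign_space. C x y = (sign_form x y :: 'k))"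
  then obtain C :: "(nat \<Rightarrow>\<^sub>C 'k) \<Rightarrow> (nat \<Rightarrow>\<^sub>C 'k) \<Rightarrow> 'k" where C: "continuous_bilinear_form_on c0 C"
    and ext: "\<And>x y. x \<in> sign_space \<Longrightarrow> y \<in> sign_space \<Longrightarrow> C x y = sign_form x y"
    by blast
  obtain M where M: "\<And>x y. x \<in> c0 \<Longrightarrow> y \<in> c0 \<Longrightarrow> norm x \<le> 2 \<Longrightarrow> norm y \<le> 2 \<Longrightarrow> norm (C x y) \<le> M"
    using continuous_bilinear_form_bounded_on_balls[OF subspace_c0 C, of 2] by auto
  have "2 ^ k \<le> M" for k
  proof -
    have "C (unit_seq (free_index k l)) (sign_seq k l) = of_real ((1/2) ^ k)" if "l < block_size k" for l
      using that by (simp add: ext unit_seq_free_in_sign_space sign_seq_in_sign_space sign_form_sign_seq)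
    then have "(\<Sum>l<block_size k. C (unit_seq (free_index k l)) (sign_seq k l))
        = of_real (of_nat (block_size k) * (1/2) ^ k)"
      by simp
    then have "norm (\<Sum>l<block_size k. C (unit_seq (free_index k l)) (sign_seq k l))
        = of_nat (block_size k) * (1/2) ^ k"
      by (simp only: norm_of_real) simp
    moreover have "norm (\<Sum>l<block_size k. C (unit_seq (free_index k l)) (sign_seq k l))
        \<le> sqrt (block_size k) * M"
      unfolding sign_seq_def
      by (rule bilinear_form_unit_seq_bound[OF C M])
        (auto simp: inj_on_def abs_sign_vector_le sign_vector_tendsto_0)
    moreover have "sqrt (block_size k) = 4 ^ k"
      by (simp add: block_size_def real_sqrt_power)
    moreover have "real (block_size k) * (1/2) ^ k = 4 ^ k * 2 ^ k"
      by (simp add: block_size_def power_mult_distrib[symmetric])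
    ultimately have "(4::real) ^ k * 2 ^ k \<le> 4 ^ k * M"
      by simp
    then show ?thesis
      by simp
  qed
  moreover obtain k where "M < 2 ^ k"
    using real_arch_pow[of 2 M] by auto
  ultimately show False
    by (meson not_le)
qed

text \<open>
  The sign hypothesis bounds the \<open>\<ell>\<^sub>1\<close> norm of the coefficients of \<open>y\<close> by \<open>2 * norm y\<close>, since a
  member of \<open>sign_space\<close> has every signed sum among its coordinates.  Each block form is thus
  bounded by 2 uniformly in \<open>k\<close>, and the geometric weights sum to 2.
\<close>

lemma sign_form_continuous_bilinear:
  assumes signs: "\<And>N (a :: nat \<Rightarrow> 'k::{real_normed_field,banach}).
      \<exists>S\<subseteq>{..<N}. (\<Sum>i<N. norm (a i)) \<le> 2 * norm (\<Sum>i<N. sign S i * a i)"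
  shows "continuous_bilinear_form_on sign_space (sign_form :: (nat \<Rightarrow>\<^sub>C 'k) \<Rightarrow> (nat \<Rightarrow>\<^sub>C 'k) \<Rightarrow> 'k)"
proof -
  have block_bound: "norm (block_form k x y) \<le> 2 * norm x * norm y"
    if y: "y \<in> sign_space" for k and x y :: "nat \<Rightarrow>\<^sub>C 'k"
  proof -
    obtain S where S: "S \<subseteq> {..<block_size k}"
      and le: "(\<Sum>i<block_size k. norm (apply_bcontfun y (coeff_index k i)))
        \<le> 2 * norm (\<Sum>i<block_size k. sign S i * apply_bcontfun y (coeff_index k i))"
      using signs[where N = "block_size k" and a = "\<lambda>i. apply_bcontfun y (coeff_index k i)"] by auto
    have "norm (block_form k x y)
        \<le> (\<Sum>i<block_size k. norm x * norm (apply_bcontfun y (coeff_index k i)))"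
      unfolding block_form_def
      by (rule sum_norm_le) (simp add: norm_mult mult_right_mono norm_bounded)
    also have "\<dots> = norm x * (\<Sum>i<block_size k. norm (apply_bcontfun y (coeff_index k i)))"
      by (simp add: sum_distrib_left)
    also have "\<dots> \<le> norm x * (2 * norm (apply_bcontfun y (sum_index k S)))"
      using le y S by (intro mult_left_mono) (auto simp: sign_space_def)
    also have "\<dots> \<le> norm x * (2 * norm y)"
      by (intro mult_left_mono norm_bounded) auto
    finally show ?thesis
      by (simp add: mult_ac)
  qed
  have term_bound: "norm (of_real ((1/2) ^ k) * block_form k x y) \<le> (1/2) ^ k * (2 * norm x * norm y)"
    if "y \<in> sign_space" for k and x y :: "nat \<Rightarrow>\<^sub>C 'k"
    unfolding norm_mult norm_of_real using block_bound[OF that] by (simp add: mult_left_mono)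
  have majorant: "(\<lambda>k. (1/2) ^ k * (2 * norm x * norm y)) sums (4 * norm x * norm y)"
    for x y :: "nat \<Rightarrow>\<^sub>C 'k"
    using sums_mult2[OF geometric_sums[of "1/2 :: real"], of "2 * norm x * norm y"]
    by (simp add: mult.assoc)
  have summable: "summable (\<lambda>k. of_real ((1/2) ^ k) * block_form k x y)"
    if "y \<in> sign_space" for x y :: "nat \<Rightarrow>\<^sub>C 'k"
    by (rule summable_comparison_test'[OF sums_summable[OF majorant], of 0]) (rule term_bound[OF that])
  show ?thesis
  proof (rule continuous_bilinear_form_onI[OF subspace_sign_space, where M = 4])
    fix x x' y :: "nat \<Rightarrow>\<^sub>C 'k"
    assume "y \<in> sign_space"
    then show "sign_form (x + x') y = sign_form x y + sign_form x' y"
      unfolding sign_form_def block_form_linear distrib_left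
      by (intro suminf_add[symmetric] summable)
  next
    fix x y y' :: "nat \<Rightarrow>\<^sub>C 'k"
    assume "y \<in> sign_space" "y' \<in> sign_space"
    then show "sign_form x (y + y') = sign_form x y + sign_form x y'"
      unfolding sign_form_def block_form_linear distrib_left
      by (intro suminf_add[symmetric] summable)
  next
    fix a :: 'k and x y :: "nat \<Rightarrow>\<^sub>C 'k"
    assume "y \<in> sign_space"
    then show "sign_form (scale_seq a x) y = a * sign_form x y"
      unfolding sign_form_def block_form_linear mult.left_commute[of _ a]
      by (intro suminf_mult summable)
  next
    fix a :: 'k and x y :: "nat \<Rightarrow>\<^sub>C 'k"
    assume "y \<in> sign_space"
    then show "sign_form x (scale_seq a y) = a * sign_form x y"
      unfolding sign_form_def block_form_linear mult.left_commute[of _ a]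
      by (intro suminf_mult summable)
  next
    fix x y :: "nat \<Rightarrow>\<^sub>C 'k"
    assume y: "y \<in> sign_space"
    have "norm (sign_form x y) \<le> (\<Sum>k. (1/2) ^ k * (2 * norm x * norm y))"
      unfolding sign_form_def
      by (rule norm_suminf_le[OF term_bound[OF y] sums_summable[OF majorant]])
    then show "norm (sign_form x y) \<le> 4 * norm x * norm y"
      using sums_unique[OF majorant, of x y] by simp
  qed
qed


section \<open>Signed sums of real and complex numbers\<close>

lemma real_signs:
  fixes a :: "nat \<Rightarrow> real"
  shows "(\<Sum>i<N. \<bar>a i\<bar>) = (\<Sum>i<N. sign {i. i < N \<and> a i \<ge> 0} i * a i)"
  by (intro sum.cong) (auto simp: sign_def)

lemma real_signs_norm:
  fixes a :: "nat \<Rightarrow> real"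
  shows "\<exists>S\<subseteq>{..<N}. (\<Sum>i<N. norm (a i)) \<le> 2 * norm (\<Sum>i<N. sign S i * a i)"
  using real_signs[where a = a and N = N] sum_nonneg[of "{..<N}" "\<lambda>i. \<bar>a i\<bar>"]
  by (intro exI[of _ "{i. i < N \<and> a i \<ge> 0}"]) auto

lemma Re_sign_sum:
  "Re (\<Sum>i\<in>I. sign S i * a i) = (\<Sum>i\<in>I. sign S i * Re (a i))"
  "Im (\<Sum>i\<in>I. sign S i * a i) = (\<Sum>i\<in>I. sign S i * Im (a i))"
  by (auto simp: sign_def intro!: sum.cong)

text \<open>
  The real or the imaginary parts account for at least half of \<open>\<Sum>i. norm (a i)\<close>; the signs are
  those of the parts that do.
\<close>

lemma complex_signs_norm:
  fixes a :: "nat \<Rightarrow> complex"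
  shows "\<exists>S\<subseteq>{..<N}. (\<Sum>i<N. norm (a i)) \<le> 2 * norm (\<Sum>i<N. sign S i * a i)"
proof -
  define r s where "r = (\<Sum>i<N. \<bar>Re (a i)\<bar>)" and "s = (\<Sum>i<N. \<bar>Im (a i)\<bar>)"
  have total: "(\<Sum>i<N. norm (a i)) \<le> r + s"
    unfolding r_def s_def sum.distrib[symmetric] by (intro sum_mono cmod_le)
  define S T where "S = {i. i < N \<and> Re (a i) \<ge> 0}" and "T = {i. i < N \<and> Im (a i) \<ge> 0}"
  have "r = Re (\<Sum>i<N. sign S i * a i)" "s = Im (\<Sum>i<N. sign T i * a i)"
    unfolding Re_sign_sum r_def s_def S_def T_def by (rule real_signs)+
  then have rs: "r \<le> norm (\<Sum>i<N. sign S i * a i)" "s \<le> norm (\<Sum>i<N. sign T i * a i)"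
    using complex_Re_le_cmod abs_Im_le_cmod[of "\<Sum>i<N. sign T i * a i"] by (metis, linarith)
  show ?thesis
  proof (cases "s \<le> r")
    case True
    then show ?thesis
      using total rs by (intro exI[of _ S]) (auto simp: S_def)
  next
    case False
    then show ?thesis
      using total rs by (intro exI[of _ T]) (auto simp: T_def)
  qed
qed


section \<open>A form without continuous extension\<close>

theorem corollary2:
  shows
    "(\<exists>(Y :: (nat \<Rightarrow>\<^sub>C real) set) B.
        seq.subspace Y \<and> closedin (top_of_set c0) Y \<and>
        continuous_bilinear_form_on Y B \<and>
        \<not> (\<exists>C. continuous_bilinear_form_on c0 C \<and> (\<forall>x\<in>Y. \<forall>y\<in>Y. C x y = B x y))) \<and>
     (\<exists>(Y :: (nat \<Rightarrow>\<^sub>C complex) set) B.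
        seq.subspace Y \<and> closedin (top_of_set c0) Y \<and>
        continuous_bilinear_form_on Y B \<and>
        \<not> (\<exists>C. continuous_bilinear_form_on c0 C \<and> (\<forall>x\<in>Y. \<forall>y\<in>Y. C x y = B x y)))"
  by (intro conjI exI[of _ sign_space] exI[of _ sign_form] subspace_sign_space closedin_sign_space
      not_extendable_sign_form sign_form_continuous_bilinear real_signs_norm complex_signs_norm)

end
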